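(* Let $A_1,\ldots,A_r$ be any subgroups of a group $G$, with intersection $I=\bigcap_{i=1}^r A_i$. Then in the HNN-extension $G*_{A_1,\ldots,A_r}(t_1,\ldots,t_r)$ we have $$G\cap G^{t_1\cdots t_r}=I.$$
   Context: Notation: $x^y=y^{-1}xy$ and $G^y=y^{-1}Gy$. For subgroups $A_1,\ldots,A_r\le G$, $G*_{A_1,\ldots,A_r}(t_1,\ldots,t_r)$ denotes the multiple HNN-extension $\langle G,t_1,\ldots,t_r\mid a^{t_i}=a\text{ for all }a\in A_i,\ i=1,\ldots,r\rangle$. The group $G$ is identified with its natural image in it. *)

theory Defs
  imports "HOL-Algebra.Group"
begin

section \<open>Groups given by generators and relations\<close>

text \<open>A word is a list of signed letters: \<open>(x, True)\<close> stands for the generator \<open>x\<close> and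
  \<open>(x, False)\<close> for its formal inverse.\<close>

type_synonym 'x word = "('x \<times> bool) list"

definition words :: "'x set \<Rightarrow> 'x word set"
  where "words X = lists (X \<times> UNIV)"

text \<open>A pair \<open>(l, m)\<close> in \<open>R\<close> stands for the defining relation \<open>l = m\<close>. The predicate below is the
  least congruence on the words over \<open>X\<close> that contains \<open>R\<close> and all free cancellations.\<close>

inductive pres_eq :: "'x set \<Rightarrow> ('x word \<times> 'x word) set \<Rightarrow> 'x word \<Rightarrow> 'x word \<Rightarrow> bool"
  for X :: "'x set" and R :: "('x word \<times> 'x word) set"
where
  refl: "w \<in> words X \<Longrightarrow> pres_eq X R w w"
| sym: "pres_eq X R u v \<Longrightarrow> pres_eq X R v u"
| trans: "pres_eq X R u v \<Longrightarrow> pres_eq X R v w \<Longrightarrow> pres_eq X R u w"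
| cancel: "x \<in> X \<Longrightarrow> u \<in> words X \<Longrightarrow> v \<in> words X \<Longrightarrow>
    pres_eq X R (u @ [(x, b), (x, \<not> b)] @ v) (u @ v)"
| rel: "(l, m) \<in> R \<Longrightarrow> l \<in> words X \<Longrightarrow> m \<in> words X \<Longrightarrow> u \<in> words X \<Longrightarrow> v \<in> words X \<Longrightarrow>
    pres_eq X R (u @ l @ v) (u @ m @ v)"

definition pres_class :: "'x set \<Rightarrow> ('x word \<times> 'x word) set \<Rightarrow> 'x word \<Rightarrow> 'x word set"
  where "pres_class X R w = {v. pres_eq X R w v}"

definition presented_group :: "'x set \<Rightarrow> ('x word \<times> 'x word) set \<Rightarrow> 'x word set monoid"
  where "presented_group X R =
    \<lparr>carrier = pres_class X R ` words X,
     mult = (\<lambda>C D. \<Union>u\<in>C. \<Union>v\<in>D. pres_class X R (u @ v)),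
     one = pres_class X R []\<rparr>"

section \<open>Multiple HNN-extensions with identity stable-letter action\<close>

text \<open>The generators are the elements of \<open>G\<close> (tagged \<open>Inl\<close>) and the stable letters
  \<open>t\<^sub>1, \<dots>, t\<^sub>r\<close> (tagged \<open>Inr\<close>); the relations are the multiplication table of \<open>G\<close>
  and \<open>t\<^sub>i\<inverse> a t\<^sub>i = a\<close> for \<open>a \<in> A\<^sub>i\<close>. Only \<open>A 1, \<dots>, A r\<close> are relevant.\<close>

definition hnn_gens :: "('a, 'b) monoid_scheme \<Rightarrow> nat \<Rightarrow> ('a + nat) set"
  where "hnn_gens G r = Inl ` carrier G \<union> Inr ` {1..r}"

definition hnn_rels ::
    "('a, 'b) monoid_scheme \<Rightarrow> (nat \<Rightarrow> 'a set) \<Rightarrow> nat \<Rightarrow> (('a + nat) word \<times> ('a + nat) word) set"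
  where "hnn_rels G A r =
    {([(Inl x, True), (Inl y, True)], [(Inl (x \<otimes>\<^bsub>G\<^esub> y), True)]) | x y.
        x \<in> carrier G \<and> y \<in> carrier G} \<union>
    {([(Inr i, False), (Inl a, True), (Inr i, True)], [(Inl a, True)]) | i a.
        i \<in> {1..r} \<and> a \<in> A i}"

definition HNN ::
    "('a, 'b) monoid_scheme \<Rightarrow> (nat \<Rightarrow> 'a set) \<Rightarrow> nat \<Rightarrow> ('a + nat) word set monoid"
  where "HNN G A r = presented_group (hnn_gens G r) (hnn_rels G A r)"

definition hnn_emb ::
    "('a, 'b) monoid_scheme \<Rightarrow> (nat \<Rightarrow> 'a set) \<Rightarrow> nat \<Rightarrow> 'a \<Rightarrow> ('a + nat) word set"
  where "hnn_emb G A r x = pres_class (hnn_gens G r) (hnn_rels G A r) [(Inl x, True)]"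

definition hnn_stable ::
    "('a, 'b) monoid_scheme \<Rightarrow> (nat \<Rightarrow> 'a set) \<Rightarrow> nat \<Rightarrow> nat \<Rightarrow> ('a + nat) word set"
  where "hnn_stable G A r i = pres_class (hnn_gens G r) (hnn_rels G A r) [(Inr i, True)]"

definition list_prod :: "('h, 'm) monoid_scheme \<Rightarrow> 'h list \<Rightarrow> 'h"
  where "list_prod H xs = foldr (\<otimes>\<^bsub>H\<^esub>) xs \<one>\<^bsub>H\<^esub>"

definition conj_set :: "('h, 'm) monoid_scheme \<Rightarrow> 'h set \<Rightarrow> 'h \<Rightarrow> 'h set"
  where "conj_set H S y = (\<lambda>x. inv\<^bsub>H\<^esub> y \<otimes>\<^bsub>H\<^esub> x \<otimes>\<^bsub>H\<^esub> y) ` S"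

section \<open>Well-definedness\<close>

lemma words_simps [simp]:
  "[] \<in> words X" "p # w \<in> words X \<longleftrightarrow> fst p \<in> X \<and> w \<in> words X"
  "u @ v \<in> words X \<longleftrightarrow> u \<in> words X \<and> v \<in> words X"
  by (auto simp: words_def mem_Times_iff)

lemma pres_eq_words: "pres_eq X R u v \<Longrightarrow> u \<in> words X \<and> v \<in> words X"
  by (induction rule: pres_eq.induct) auto

lemma pres_eq_context:
  assumes "pres_eq X R u v" "p \<in> words X" "q \<in> words X"
  shows "pres_eq X R (p @ u @ q) (p @ v @ q)"
  using assms(1)
proof (induction rule: pres_eq.induct)
  case (refl w)
  then show ?case using assms by (intro pres_eq.refl) simp
next
  case (cancel x u v b)
  then show ?case using pres_eq.cancel[of x X "p @ u" "v @ q" R b] assms by simp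
next
  case (rel l m u v)
  then show ?case using pres_eq.rel[of l m R X "p @ u" "v @ q"] assms by simp
next
  case (sym u v)
  then show ?case by (rule_tac pres_eq.sym)
next
  case (trans u v w)
  then show ?case by (rule_tac pres_eq.trans)
qed

lemma pres_eq_append:
  assumes "pres_eq X R u u'" "pres_eq X R v v'"
  shows "pres_eq X R (u @ v) (u' @ v')"
proof -
  have "pres_eq X R (u @ v) (u' @ v)"
    using pres_eq_context[OF assms(1), of "[]" v] pres_eq_words[OF assms(2)] by simp
  moreover have "pres_eq X R (u' @ v) (u' @ v')"
    using pres_eq_context[OF assms(2), of u' "[]"] pres_eq_words[OF assms(1)] by simp
  ultimately show ?thesis by (rule pres_eq.trans)
qed

lemma pres_class_eq_iff:
  assumes "u \<in> words X"
  shows "pres_class X R u = pres_class X R v \<longleftrightarrow> pres_eq X R u v"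
proof
  assume "pres_class X R u = pres_class X R v"
  moreover have "u \<in> pres_class X R u" using assms by (simp add: pres_class_def pres_eq.refl)
  ultimately show "pres_eq X R u v" by (simp add: pres_class_def pres_eq.sym)
next
  assume uv: "pres_eq X R u v"
  have "pres_eq X R u w \<longleftrightarrow> pres_eq X R v w" for w
    using pres_eq.trans[OF uv] pres_eq.trans[OF pres_eq.sym[OF uv]] by blast
  then show "pres_class X R u = pres_class X R v" by (simp add: pres_class_def)
qed

lemma presented_group_mult:
  assumes "u \<in> words X" "v \<in> words X"
  shows "pres_class X R u \<otimes>\<^bsub>presented_group X R\<^esub> pres_class X R v = pres_class X R (u @ v)"
proof -
  have eq: "pres_class X R (u' @ v') = pres_class X R (u @ v)"
    if "u' \<in> pres_class X R u" "v' \<in> pres_class X R v" for u' v'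
  proof -
    have "pres_eq X R (u @ v) (u' @ v')"
      using that by (auto simp: pres_class_def intro: pres_eq_append)
    then show ?thesis
      using pres_class_eq_iff[of "u @ v" X R "u' @ v'"] assms by simp
  qed
  have mem: "u \<in> pres_class X R u" "v \<in> pres_class X R v"
    using assms by (simp_all add: pres_class_def pres_eq.refl)
  have "(\<Union>u'\<in>pres_class X R u. \<Union>v'\<in>pres_class X R v. pres_class X R (u' @ v'))
      = (\<Union>u'\<in>pres_class X R u. \<Union>v'\<in>pres_class X R v. pres_class X R (u @ v))"
    by (intro SUP_cong HOL.refl eq)
  also have "\<dots> = pres_class X R (u @ v)" using mem by blast
  finally show ?thesis by (simp add: presented_group_def)
qed

lemma pres_eq_inverse:
  "w \<in> words X \<Longrightarrow> pres_eq X R (rev (map (\<lambda>(x, b). (x, \<not> b)) w) @ w) []"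
proof (induction w)
  case Nil
  then show ?case by (simp add: pres_eq.refl)
next
  case (Cons p w)
  obtain x b where p: "p = (x, b)" by force
  let ?v = "rev (map (\<lambda>(x, b). (x, \<not> b)) w)"
  have v: "?v \<in> words X" using Cons pres_eq_words by force
  have "pres_eq X R (?v @ [(x, \<not> b), (x, \<not> \<not> b)] @ w) (?v @ w)"
    using Cons.prems v p by (intro pres_eq.cancel) auto
  then have "pres_eq X R (?v @ [(x, \<not> b), (x, b)] @ w) []"
    using Cons pres_eq.trans by (fastforce simp: p)
  then show ?case by (simp add: p)
qed

theorem group_presented_group: "group (presented_group X R)"
proof (rule groupI)
  let ?H = "presented_group X R"
  have car: "carrier ?H = pres_class X R ` words X" and one: "\<one>\<^bsub>?H\<^esub> = pres_class X R []"
    by (simp_all add: presented_group_def)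
  show "\<one>\<^bsub>?H\<^esub> \<in> carrier ?H" by (simp add: car one)
  show "C \<otimes>\<^bsub>?H\<^esub> D \<in> carrier ?H" if "C \<in> carrier ?H" "D \<in> carrier ?H" for C D
    using that by (auto simp: car presented_group_mult)
  show "C \<otimes>\<^bsub>?H\<^esub> D \<otimes>\<^bsub>?H\<^esub> E = C \<otimes>\<^bsub>?H\<^esub> (D \<otimes>\<^bsub>?H\<^esub> E)"
    if "C \<in> carrier ?H" "D \<in> carrier ?H" "E \<in> carrier ?H" for C D E
    using that by (auto simp: car presented_group_mult)
  show "\<one>\<^bsub>?H\<^esub> \<otimes>\<^bsub>?H\<^esub> C = C" if "C \<in> carrier ?H" for C
    using that by (auto simp: car one presented_group_mult)
  show "\<exists>D\<in>carrier ?H. D \<otimes>\<^bsub>?H\<^esub> C = \<one>\<^bsub>?H\<^esub>" if C: "C \<in> carrier ?H" for C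
  proof -
    obtain w where w: "w \<in> words X" "C = pres_class X R w" using C car by auto
    let ?v = "rev (map (\<lambda>(x, b). (x, \<not> b)) w)"
    have e: "pres_eq X R (?v @ w) []" using w by (rule_tac pres_eq_inverse)
    then have v: "?v \<in> words X" using pres_eq_words by force
    have "pres_class X R ?v \<otimes>\<^bsub>?H\<^esub> C = \<one>\<^bsub>?H\<^esub>"
      using e v w pres_class_eq_iff[of "?v @ w" X R "[]"] by (simp add: presented_group_mult one)
    then show ?thesis using v car by blast
  qed
qed

definition word_eval :: "('h, 'm) monoid_scheme \<Rightarrow> ('x \<Rightarrow> 'h) \<Rightarrow> 'x word \<Rightarrow> 'h"
  where "word_eval K f w =
    list_prod K (map (\<lambda>(x, b). if b then f x else inv\<^bsub>K\<^esub> f x) w)"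

lemma (in group) word_eval_Nil [simp]: "word_eval G f [] = \<one>"
  by (simp add: word_eval_def list_prod_def)

lemma (in group) word_eval_Cons [simp]:
  "word_eval G f ((x, b) # w) = (if b then f x else inv f x) \<otimes> word_eval G f w"
  by (simp add: word_eval_def list_prod_def)

lemma (in group) word_eval_closed [simp]:
  "f \<in> X \<rightarrow> carrier G \<Longrightarrow> w \<in> words X \<Longrightarrow> word_eval G f w \<in> carrier G"
  by (induction w) (auto dest: funcset_mem)

lemma (in group) word_eval_append:
  "f \<in> X \<rightarrow> carrier G \<Longrightarrow> u \<in> words X \<Longrightarrow> v \<in> words X \<Longrightarrow>
    word_eval G f (u @ v) = word_eval G f u \<otimes> word_eval G f v"
proof (induction u)
  case (Cons p u)
  obtain x b where p: "p = (x, b)" by force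
  have "f x \<in> carrier G" using Cons.prems p by auto
  then show ?case using Cons p word_eval_closed[OF Cons.prems(1)] by (auto simp: m_assoc)
qed simp

lemma (in group) word_eval_pres_eq:
  assumes f: "f \<in> X \<rightarrow> carrier G"
    and R: "\<And>l m. (l, m) \<in> R \<Longrightarrow> word_eval G f l = word_eval G f m"
    and "pres_eq X R u v"
  shows "word_eval G f u = word_eval G f v"
  using assms(3)
proof (induction rule: pres_eq.induct)
  case (cancel x u v b)
  have fx: "f x \<in> carrier G" using f cancel by auto
  have "word_eval G f ([(x, b), (x, \<not> b)] @ v) = word_eval G f v"
    using fx word_eval_closed[OF f] cancel by (auto simp: m_assoc[symmetric])
  then show ?case using cancel word_eval_append[OF f] by simp
next
  case (rel l m u v)
  then show ?case using word_eval_append[OF f] R by simp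
qed simp_all

theorem group_HNN: "group (HNN G A r)"
  by (simp add: HNN_def group_presented_group)

theorem hnn_emb_hom:
  assumes "group G"
  shows "hnn_emb G A r \<in> hom G (HNN G A r)"
proof (rule homI)
  interpret group G by (rule assms)
  fix x y assume xy: "x \<in> carrier G" "y \<in> carrier G"
  let ?X = "hnn_gens G r" and ?R = "hnn_rels G A r"
  have gens: "Inl z \<in> ?X" if "z \<in> carrier G" for z
    using that by (auto simp: hnn_gens_def)
  show "hnn_emb G A r x \<in> carrier (HNN G A r)"
    using xy gens by (auto simp: hnn_emb_def HNN_def presented_group_def)
  have "([(Inl x, True), (Inl y, True)], [(Inl (x \<otimes>\<^bsub>G\<^esub> y), True)]) \<in> ?R"
    using xy by (auto simp: hnn_rels_def)
  from pres_eq.rel[OF this, of ?X "[]" "[]"]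
  have "pres_eq ?X ?R [(Inl x, True), (Inl y, True)] [(Inl (x \<otimes>\<^bsub>G\<^esub> y), True)]"
    using xy gens by simp
  then show "hnn_emb G A r (x \<otimes>\<^bsub>G\<^esub> y) = hnn_emb G A r x \<otimes>\<^bsub>HNN G A r\<^esub> hnn_emb G A r y"
    using xy gens by (simp add: hnn_emb_def HNN_def presented_group_mult pres_class_eq_iff
        pres_eq.sym)
qed

text \<open>Sending every stable letter to \<open>\<one>\<close> retracts the HNN-extension onto \<open>G\<close>; hence
  \<open>G\<close> may be identified with its image under \<^term>\<open>hnn_emb G A r\<close>.\<close>

theorem hnn_emb_inj_on:
  assumes "group G" "\<And>i. i \<in> {1..r} \<Longrightarrow> subgroup (A i) G"
  shows "inj_on (hnn_emb G A r) (carrier G)"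
proof (rule inj_onI)
  interpret group G by (rule assms)
  fix x y assume xy: "x \<in> carrier G" "y \<in> carrier G" "hnn_emb G A r x = hnn_emb G A r y"
  let ?X = "hnn_gens G r" and ?R = "hnn_rels G A r"
  let ?f = "case_sum (\<lambda>z. z) (\<lambda>_::nat. \<one>\<^bsub>G\<^esub>)"
  have f: "?f \<in> ?X \<rightarrow> carrier G" by (auto simp: hnn_gens_def)
  have R: "word_eval G ?f l = word_eval G ?f m" if "(l, m) \<in> ?R" for l m
    using that subgroup.mem_carrier[OF assms(2)] by (auto simp: hnn_rels_def)
  have "pres_eq ?X ?R [(Inl x, True)] [(Inl y, True)]"
    using xy by (subst pres_class_eq_iff[symmetric]) (auto simp: hnn_emb_def hnn_gens_def)
  from word_eval_pres_eq[OF f R this] show "x = y" using xy by simp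
qed

end

theory Submission
  imports Defs "HOL-Algebra.Bij"
begin

text \<open>Elements of \<open>I\<close> commute with every stable letter, hence are fixed by conjugation with
  \<open>t = t\<^sub>1 \<cdots> t\<^sub>r\<close>; this gives one inclusion.

  For the other one, let \<open>t\<inverse> h t = g\<close> with \<open>g, h \<in> G\<close>. The normal form theorem for
  HNN-extensions is avoided by testing the equation \<open>h t = t g\<close> in one permutation group for each
  \<open>i\<close>. Let \<open>G\<close> act by left translations on two copies (sheets) of itself, let \<open>t\<^sub>i\<close> exchange the
  two sheets over the points of \<open>A\<^sub>i\<close> only, and let all other stable letters act trivially. The
  exchange commutes with left translations by elements of \<open>A\<^sub>i\<close>, since these preserve both \<open>A\<^sub>i\<close>
  and its complement; so this is an action of the whole HNN-extension (lemma
  \<open>hnn_word_eval_eq\<close>). Since \<open>t\<^sub>i\<close> occurs exactly once in \<open>t\<close>, the product \<open>t\<close> acts as the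
  exchange. Follow the point over \<open>\<one>\<close> in the first sheet: \<open>h t\<close> carries it to the second sheet,
  whereas \<open>t g\<close> does so only if the exchange moves the point over \<open>g\<close>, that is, if
  \<open>g \<in> A\<^sub>i\<close> (lemma \<open>translation_swap_mem\<close>).\<close>

section \<open>A permutation representation detecting a subgroup\<close>

definition sheets :: "('a, 'b) monoid_scheme \<Rightarrow> ('a \<times> bool) set"
  where "sheets G = carrier G \<times> UNIV"

definition translation :: "('a, 'b) monoid_scheme \<Rightarrow> 'a \<Rightarrow> 'a \<times> bool \<Rightarrow> 'a \<times> bool"
  where "translation G g = (\<lambda>(x, b)\<in>sheets G. (g \<otimes>\<^bsub>G\<^esub> x, b))"

definition sheet_swap :: "('a, 'b) monoid_scheme \<Rightarrow> 'a set \<Rightarrow> 'a \<times> bool \<Rightarrow> 'a \<times> bool"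
  where "sheet_swap G A = (\<lambda>(x, b)\<in>sheets G. (x, if x \<in> A then \<not> b else b))"

lemma (in group) translation_closed:
  assumes "g \<in> carrier G"
  shows "translation G g \<in> carrier (BijGroup (sheets G))"
proof -
  have "bij_betw (translation G g) (sheets G) (sheets G)"
    by (rule bij_betw_byWitness[where f' = "translation G (inv g)"])
      (use assms in \<open>auto simp: translation_def sheets_def m_assoc[symmetric]\<close>)
  then show ?thesis by (simp add: BijGroup_def Bij_def translation_def)
qed

lemma sheet_swap_closed: "sheet_swap G A \<in> carrier (BijGroup (sheets G))"
proof -
  have "bij_betw (sheet_swap G A) (sheets G) (sheets G)"
    by (rule bij_betw_byWitness[where f' = "sheet_swap G A"])
      (auto simp: sheet_swap_def sheets_def)
  then show ?thesis by (simp add: BijGroup_def Bij_def sheet_swap_def)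
qed

lemma BijGroup_mult:
  assumes "f \<in> carrier (BijGroup S)" "f' \<in> carrier (BijGroup S)"
  shows "f \<otimes>\<^bsub>BijGroup S\<^esub> f' = compose S f f'"
  using assms by (simp add: BijGroup_def)

lemma (in group) translation_hom: "translation G \<in> hom G (BijGroup (sheets G))"
proof (rule homI)
  fix x y assume xy: "x \<in> carrier G" "y \<in> carrier G"
  then have "translation G (x \<otimes> y) = compose (sheets G) (translation G x) (translation G y)"
    by (auto simp: compose_def translation_def sheets_def m_assoc restrict_def fun_eq_iff)
  with xy show "translation G (x \<otimes> y)
      = translation G x \<otimes>\<^bsub>BijGroup (sheets G)\<^esub> translation G y"
    by (simp add: BijGroup_mult translation_closed)
qed (rule translation_closed)

text \<open>Left translation by an element of the subgroup maps \<open>A\<close> to itself and its complement to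
  itself, so it does not matter whether the sheets are exchanged before or after translating.\<close>

lemma (in group) translation_swap_commute:
  assumes A: "subgroup A G" and a: "a \<in> A"
  shows "translation G a \<otimes>\<^bsub>BijGroup (sheets G)\<^esub> sheet_swap G A
    = sheet_swap G A \<otimes>\<^bsub>BijGroup (sheets G)\<^esub> translation G a"
proof -
  have aG: "a \<in> carrier G" using A a by (rule subgroup.mem_carrier)
  have "a \<otimes> x \<in> A \<longleftrightarrow> x \<in> A" if "x \<in> carrier G" for x
  proof
    assume "a \<otimes> x \<in> A"
    then have "inv a \<otimes> (a \<otimes> x) \<in> A"
      using A a by (simp add: subgroup.m_closed subgroup.m_inv_closed)
    then show "x \<in> A" using aG that by (simp add: m_assoc[symmetric])
  qed (use A a in \<open>simp add: subgroup.m_closed\<close>)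
  with aG have "compose (sheets G) (translation G a) (sheet_swap G A)
      = compose (sheets G) (sheet_swap G A) (translation G a)"
    by (auto simp: compose_def translation_def sheet_swap_def sheets_def restrict_def fun_eq_iff)
  with aG show ?thesis
    by (simp add: BijGroup_mult translation_closed sheet_swap_closed)
qed

text \<open>Conversely, an exchange of sheets intertwines two translations only if these are by elements
  of the subgroup: compare the sheets to which the point \<open>(\<one>, False)\<close> is carried.\<close>

lemma (in group) translation_swap_mem:
  assumes A: "subgroup A G" and gh: "g \<in> carrier G" "h \<in> carrier G"
    and eq: "translation G h \<otimes>\<^bsub>BijGroup (sheets G)\<^esub> sheet_swap G A
      = sheet_swap G A \<otimes>\<^bsub>BijGroup (sheets G)\<^esub> translation G g"
  shows "g \<in> A"
proof -
  have "compose (sheets G) (translation G h) (sheet_swap G A) (\<one>, False)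
      = compose (sheets G) (sheet_swap G A) (translation G g) (\<one>, False)"
    using eq gh by (simp add: BijGroup_mult translation_closed sheet_swap_closed)
  then show ?thesis
    using gh subgroup.one_closed[OF A]
    by (auto simp: compose_def translation_def sheet_swap_def sheets_def split: if_splits)
qed

section \<open>Words in a multiple HNN-extension\<close>

text \<open>The universal property: a homomorphism on \<open>G\<close> and images of the stable letters define a
  representation of the HNN-extension as soon as the image of \<open>t\<^sub>i\<close> centralises that of
  \<open>A\<^sub>i\<close>.\<close>

lemma hnn_word_eval_eq:
  assumes "group K" and \<phi>: "\<phi> \<in> hom G K" and \<tau>: "\<tau> \<in> {1..r} \<rightarrow> carrier K"
    and A: "\<And>i. i \<in> {1..r} \<Longrightarrow> A i \<subseteq> carrier G"
    and comm: "\<And>i a. i \<in> {1..r} \<Longrightarrow> a \<in> A i \<Longrightarrow> \<phi> a \<otimes>\<^bsub>K\<^esub> \<tau> i = \<tau> i \<otimes>\<^bsub>K\<^esub> \<phi> a"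
    and "pres_eq (hnn_gens G r) (hnn_rels G A r) u v"
  shows "word_eval K (case_sum \<phi> \<tau>) u = word_eval K (case_sum \<phi> \<tau>) v"
proof -
  interpret K: group K by fact
  have \<phi>K: "\<phi> x \<in> carrier K" if "x \<in> carrier G" for x
    using \<phi> that by (rule hom_in_carrier)
  show ?thesis
  proof (rule K.word_eval_pres_eq[OF _ _ assms(6)])
    show "case_sum \<phi> \<tau> \<in> hnn_gens G r \<rightarrow> carrier K"
      using \<phi>K \<tau> by (auto simp: hnn_gens_def)
  next
    have "inv\<^bsub>K\<^esub> \<tau> i \<otimes>\<^bsub>K\<^esub> (\<phi> a \<otimes>\<^bsub>K\<^esub> \<tau> i) = \<phi> a" if "i \<in> {1..r}" "a \<in> A i" for i a
    proof -
      have "\<phi> a \<in> carrier K" "\<tau> i \<in> carrier K" using \<phi>K \<tau> A that by auto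
      then show ?thesis by (simp add: comm[OF that] K.m_assoc[symmetric])
    qed
    then show "word_eval K (case_sum \<phi> \<tau>) l = word_eval K (case_sum \<phi> \<tau>) m"
      if "(l, m) \<in> hnn_rels G A r" for l m
      using that \<phi>K \<tau> subsetD[OF A] by (auto simp: hnn_rels_def hom_mult[OF \<phi>] Pi_iff)
  qed
qed

definition stable_word :: "nat list \<Rightarrow> ('a + nat) word"
  where "stable_word js = map (\<lambda>j. (Inr j, True)) js"

lemma stable_word_simps [simp]:
  "stable_word [] = []" "stable_word (j # js) = (Inr j, True) # stable_word js"
  by (simp_all add: stable_word_def)

lemma stable_word_in_words:
  "set js \<subseteq> {1..r} \<Longrightarrow> stable_word js \<in> words (hnn_gens G r)"
  by (induction js) (auto simp: hnn_gens_def)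

lemma list_prod_hnn_stable:
  "set js \<subseteq> {1..r} \<Longrightarrow> list_prod (HNN G A r) (map (hnn_stable G A r) js)
    = pres_class (hnn_gens G r) (hnn_rels G A r) (stable_word js)"
proof (induction js)
  case Nil
  then show ?case by (simp add: list_prod_def HNN_def presented_group_def)
next
  case (Cons j js)
  then have "Inr j \<in> hnn_gens G r" "stable_word js \<in> words (hnn_gens G r)"
    using stable_word_in_words[of js r G] by (auto simp: hnn_gens_def)
  with Cons show ?case
    by (simp add: list_prod_def hnn_stable_def HNN_def presented_group_mult)
qed

lemma (in group) word_eval_stable_word_single:
  assumes "s \<in> carrier G" "distinct js"
  shows "word_eval G (case_sum \<phi> (\<lambda>j. if j = i then s else \<one>)) (stable_word js)
    = (if i \<in> set js then s else \<one>)"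
  using assms(2) by (induction js) (use assms(1) in auto)

text \<open>An element common to all \<open>A\<^sub>j\<close> can be moved past the stable letters one at a time, by the
  relation \<open>t\<^sub>j\<inverse> a t\<^sub>j = a\<close> multiplied by \<open>t\<^sub>j\<close> on the left.\<close>

lemma pres_eq_commute_stable_word:
  assumes js: "set js \<subseteq> {1..r}" and a: "a \<in> carrier G" "\<And>j. j \<in> {1..r} \<Longrightarrow> a \<in> A j"
  shows "pres_eq (hnn_gens G r) (hnn_rels G A r)
    ((Inl a, True) # stable_word js) (stable_word js @ [(Inl a, True)])"
  using js
proof (induction js)
  case Nil
  then show ?case using a by (auto simp: hnn_gens_def intro!: pres_eq.refl)
next
  case (Cons j js)
  let ?X = "hnn_gens G r" and ?R = "hnn_rels G A r"
  let ?a = "(Inl a, True)" and ?t = "(Inr j, True)" and ?t' = "(Inr j, False)"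
  have j: "j \<in> {1..r}" using Cons.prems by simp
  have gens: "Inl a \<in> ?X" "Inr j \<in> ?X" using a j by (auto simp: hnn_gens_def)
  have "pres_eq ?X ?R ([?t, ?t'] @ [?a, ?t]) [?a, ?t]"
    using pres_eq.cancel[of "Inr j" ?X "[]" "[?a, ?t]" ?R True] gens by simp
  moreover have "([?t', ?a, ?t], [?a]) \<in> ?R"
    using a j by (auto simp: hnn_rels_def)
  then have "pres_eq ?X ?R ([?t, ?t'] @ [?a, ?t]) [?t, ?a]"
    using pres_eq.rel[of "[?t', ?a, ?t]" "[?a]" ?R ?X "[?t]" "[]"] gens by simp
  ultimately have "pres_eq ?X ?R [?a, ?t] [?t, ?a]"
    by (blast intro: pres_eq.sym pres_eq.trans)
  then have "pres_eq ?X ?R ([?a, ?t] @ stable_word js) ([?t, ?a] @ stable_word js)"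
    using stable_word_in_words[of js r G] Cons.prems
    by (intro pres_eq_append pres_eq.refl) auto
  moreover have "pres_eq ?X ?R ([?t] @ ?a # stable_word js)
      ([?t] @ stable_word js @ [?a])"
    using Cons gens by (intro pres_eq_append[of _ _ "[?t]"] pres_eq.refl) auto
  ultimately show ?case by (auto intro: pres_eq.trans)
qed

text \<open>Mapping all stable letters except the \<open>i\<close>-th to \<open>\<one>\<close> reduces the product of all of them to a
  single exchange of sheets, and the permutation representation for \<open>A\<^sub>i\<close> applies.\<close>

lemma pres_eq_stable_word_mem:
  assumes "group G" and A: "\<And>j. j \<in> {1..r} \<Longrightarrow> subgroup (A j) G"
    and gh: "g \<in> carrier G" "h \<in> carrier G"
    and js: "set js \<subseteq> {1..r}" "distinct js" and i: "i \<in> set js"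
    and eq: "pres_eq (hnn_gens G r) (hnn_rels G A r)
      ((Inl h, True) # stable_word js) (stable_word js @ [(Inl g, True)])"
  shows "g \<in> A i"
proof -
  interpret group G by fact
  let ?K = "BijGroup (sheets G)"
  interpret K: group ?K by (rule group_BijGroup)
  define s where "s = sheet_swap G (A i)"
  define \<tau> where "\<tau> j = (if j = i then s else \<one>\<^bsub>?K\<^esub>)" for j :: nat
  let ?f = "case_sum (translation G) \<tau>"
  have s: "s \<in> carrier ?K" by (simp add: s_def sheet_swap_closed)
  have \<tau>: "\<tau> \<in> {1..r} \<rightarrow> carrier ?K" using s by (simp add: \<tau>_def)
  have f: "?f \<in> hnn_gens G r \<rightarrow> carrier ?K"
    using \<tau> by (auto simp: hnn_gens_def translation_closed)
  have ts: "word_eval ?K ?f (stable_word js) = s"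
    using K.word_eval_stable_word_single[OF s js(2), of "translation G" i] i
    by (simp add: \<tau>_def[abs_def])
  have "word_eval ?K ?f ((Inl h, True) # stable_word js)
      = word_eval ?K ?f (stable_word js @ [(Inl g, True)])"
  proof (rule hnn_word_eval_eq[OF group_BijGroup translation_hom \<tau> _ _ eq])
    show "A j \<subseteq> carrier G" if "j \<in> {1..r}" for j
      using A[OF that] by (rule subgroup.subset)
    show "translation G a \<otimes>\<^bsub>?K\<^esub> \<tau> j = \<tau> j \<otimes>\<^bsub>?K\<^esub> translation G a"
      if "j \<in> {1..r}" "a \<in> A j" for j a
      using translation_swap_commute[OF A that(2)] subgroup.mem_carrier[OF A that(2)] that(1)
      by (auto simp: \<tau>_def s_def translation_closed)
  qed
  then have "translation G h \<otimes>\<^bsub>?K\<^esub> s = s \<otimes>\<^bsub>?K\<^esub> translation G g"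
    using ts gh js stable_word_in_words[of js r G]
    by (simp add: K.word_eval_append[OF f] translation_closed hnn_gens_def)
  then show ?thesis
    using translation_swap_mem[OF A gh] i js unfolding s_def by blast
qed

section \<open>The intersection of \<open>G\<close> with its conjugate\<close>

theorem lemma4p3:
  fixes G :: "('a, 'b) monoid_scheme" and A :: "nat \<Rightarrow> 'a set" and r :: nat
  assumes "group G"
    and "\<And>i. i \<in> {1..r} \<Longrightarrow> subgroup (A i) G"
  shows "hnn_emb G A r ` carrier G \<inter>
      conj_set (HNN G A r) (hnn_emb G A r ` carrier G)
        (list_prod (HNN G A r) (map (hnn_stable G A r) [1..<Suc r]))
    = hnn_emb G A r ` (carrier G \<inter> (\<Inter>i\<in>{1..r}. A i))"
proof -
  let ?X = "hnn_gens G r" and ?R = "hnn_rels G A r" and ?H = "HNN G A r"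
  let ?e = "hnn_emb G A r"
  let ?w = "stable_word [1..<Suc r]"
  define t where "t = list_prod ?H (map (hnn_stable G A r) [1..<Suc r])"
  interpret H: group ?H by (rule group_HNN)
  have js: "set [1..<Suc r] \<subseteq> {1..r}" by auto
  have w: "?w \<in> words ?X" by (rule stable_word_in_words[OF js])
  have t: "t = pres_class ?X ?R ?w" unfolding t_def by (rule list_prod_hnn_stable[OF js])
  have tH: "t \<in> carrier ?H" using w by (simp add: t HNN_def presented_group_def)
  have eH: "?e x \<in> carrier ?H" if "x \<in> carrier G" for x
    using hnn_emb_hom[OF assms(1)] that by (rule hom_in_carrier)
  have conj_iff: "?e g = inv\<^bsub>?H\<^esub> t \<otimes>\<^bsub>?H\<^esub> ?e h \<otimes>\<^bsub>?H\<^esub> t \<longleftrightarrow>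
      pres_eq ?X ?R ((Inl h, True) # ?w) (?w @ [(Inl g, True)])"
    if gh: "g \<in> carrier G" "h \<in> carrier G" for g h
  proof -
    have "?e g = inv\<^bsub>?H\<^esub> t \<otimes>\<^bsub>?H\<^esub> ?e h \<otimes>\<^bsub>?H\<^esub> t \<longleftrightarrow> ?e h \<otimes>\<^bsub>?H\<^esub> t = t \<otimes>\<^bsub>?H\<^esub> ?e g"
      using tH eH gh by (auto simp: H.m_assoc H.inv_solve_left)
    also have "\<dots> \<longleftrightarrow> pres_class ?X ?R ((Inl h, True) # ?w)
        = pres_class ?X ?R (?w @ [(Inl g, True)])"
      using w gh by (simp add: t hnn_emb_def HNN_def presented_group_mult hnn_gens_def)
    also have "\<dots> \<longleftrightarrow> pres_eq ?X ?R ((Inl h, True) # ?w) (?w @ [(Inl g, True)])"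
      using w gh by (intro pres_class_eq_iff) (simp add: hnn_gens_def)
    finally show ?thesis .
  qed
  show ?thesis
    unfolding conj_set_def t_def[symmetric]
  proof (intro equalityI subsetI)
    fix x assume "x \<in> ?e ` carrier G \<inter>
      (\<lambda>x. inv\<^bsub>?H\<^esub> t \<otimes>\<^bsub>?H\<^esub> x \<otimes>\<^bsub>?H\<^esub> t) ` ?e ` carrier G"
    then obtain g h where gh: "g \<in> carrier G" "h \<in> carrier G" and x: "x = ?e g"
      and "?e g = inv\<^bsub>?H\<^esub> t \<otimes>\<^bsub>?H\<^esub> ?e h \<otimes>\<^bsub>?H\<^esub> t"
      by auto
    then have "pres_eq ?X ?R ((Inl h, True) # ?w) (?w @ [(Inl g, True)])"
      using conj_iff by blast
    then have "g \<in> A i" if "i \<in> {1..r}" for i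
      using that
      by (intro pres_eq_stable_word_mem[OF assms(1) assms(2) gh js]) auto
    then show "x \<in> ?e ` (carrier G \<inter> (\<Inter>i\<in>{1..r}. A i))" using gh x by blast
  next
    fix x assume "x \<in> ?e ` (carrier G \<inter> (\<Inter>i\<in>{1..r}. A i))"
    then obtain a where a: "a \<in> carrier G" "\<And>i. i \<in> {1..r} \<Longrightarrow> a \<in> A i" and x: "x = ?e a"
      by auto
    have "?e a = inv\<^bsub>?H\<^esub> t \<otimes>\<^bsub>?H\<^esub> ?e a \<otimes>\<^bsub>?H\<^esub> t"
      using conj_iff[OF a(1) a(1)] pres_eq_commute_stable_word[where A = A, OF js a] by simp
    then show "x \<in> ?e ` carrier G \<inter>
      (\<lambda>x. inv\<^bsub>?H\<^esub> t \<otimes>\<^bsub>?H\<^esub> x \<otimes>\<^bsub>?H\<^esub> t) ` ?e ` carrier G"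
      using a x by blast
  qed
qed

end
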